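(* Let $S$ be a set, let $(I,C)$ be an axiom-set on $S$ and let $\delta:S\times S\to\mathcal P(S)$ be an arbitrary map. For $U,V\subseteq S$ put $U\circ V=\bigcup\{\delta(a,b)\mid a\in U,\ b\in V\}$. Let $(J'',D'')$ be the axiom-set defined in three steps as follows. First, $(J,D)$ is obtained from $(I,C)$ by adding the axioms $a\lhd c\circ b$ for all $a,b,c\in S$ with $a\in b\circ c$, and $a\lhd b\circ(c\circ d)$ for all $a,b,c,d\in S$ with $a\in(b\circ c)\circ d$. Then $(J',D')$ is obtained from $(J,D)$ by adding the axioms $a\lhd D(b,j)\circ c$ for all $a,b,c\in S$, $j\in J(b)$ with $a\in b\circ c$. Finally $(J'',D'')$ is obtained from $(J',D')$ by adding the axioms $a\lhd\{c\}$ for all $a,b,c\in S$ with $a\in b\circ c$, and $a\lhd a\circ a$ for all $a\in S$. Let $\lhd$ be the basic cover generated by $(J'',D'')$. Then $(S,\lhd,\circ)$ is the least formal cover containing $\lhd_{I,C}$ and extending $\delta$. That is: $(S,\lhd,\circ)$ is a formal cover; $a\lhd_{I,C}U$ implies $a\lhd U$ for all $a\in S,\ U\subseteq S$; $a\circ b=_{\mathcal A}\delta(a,b)$ for all $a,b\in S$; and for every formal cover $(S,\lhd',\circ')$ such that $\lhd'$ contains $\lhd_{I,C}$ and $a\circ'b=_{\mathcal A'}\delta(a,b)$ for all $a,b\in S$, the cover $\lhd'$ contains $\lhd$.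
   Context: A basic cover on a set $S$ is a relation $\lhd$ between elements and subsets of $S$ such that (reflexivity) $a\in U$ implies $a\lhd U$, and (transitivity) $a\lhd U$ and $U\lhd V$ imply $a\lhd V$, where $U\lhd V$ means $b\lhd V$ for all $b\in U$. Put $\mathcal A U=\{a\in S\mid a\lhd U\}$ (and $\mathcal A'$ for $\lhd'$); $U=_{\mathcal A}V$ means $\mathcal A U=\mathcal A V$. $Sat(\mathcal A)=\{U\subseteq S\mid U=\mathcal A U\}$ is a suplattice with joins $\bigvee^{\mathcal A}_i\mathcal A U_i=\mathcal A(\bigcup_i U_i)$. Elements are identified with singletons; for a binary operation $\circ$ on $\mathcal P(S)$ write $a\circ b=\{a\}\circ\{b\}$, $U\circ c=U\circ\{c\}$, etc. An axiom-set $(I,C)$ on $S$ consists of a set $I(a)$ for each $a\in S$ and a subset $C(a,i)\subseteq S$ for each $a\in S$, $i\in I(a)$ (representing the axioms $a\lhd C(a,i)$). The basic cover $\lhd_{I,C}$ generated by it is the least basic cover with $a\lhd C(a,i)$ for all $a\in S,\ i\in I(a)$; it is inductively generated by the rules: $a\in U$ implies $a\lhd U$; and if $i\in I(a)$ and $C(a,i)\lhd U$, then $a\lhd U$. Adding axioms means enlarging the index sets $I(a)$ correspondingly. A convergent cover is a triple $(S,\lhd,\circ)$ where $\lhd$ is a basic cover on $S$ and $\circ$ is a binary operation on $\mathcal P(S)$ such that: $U_1\lhd V_1$ and $U_2\lhd V_2$ imply $U_1\circ U_2\lhd V_1\circ V_2$; $(U\circ V)\circ W\lhd U\circ(V\circ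 W)$; $U\circ V\lhd V\circ U$; and the well-defined operation $\mathcal A U\circ^{\mathcal A}\mathcal A V=\mathcal A(U\circ V)$ on $Sat(\mathcal A)$ distributes over arbitrary joins $\bigvee^{\mathcal A}$. A formal cover is a convergent cover with $\mathcal A(U\circ V)=\mathcal A U\cap\mathcal A V$ for all $U,V\subseteq S$. *)

theory Defs
  imports Main
begin

text \<open>
  The set \<open>S\<close> is an explicit carrier, so that it may be empty. Relations, operations and
  families only matter on elements and subsets of \<open>S\<close>; all conditions are relativised.
\<close>

definition sub_cover :: "('a \<Rightarrow> 'a set \<Rightarrow> bool) \<Rightarrow> 'a set \<Rightarrow> 'a set \<Rightarrow> bool" where
  "sub_cover cov U V \<longleftrightarrow> (\<forall>b\<in>U. cov b V)"

locale basic_cover =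
  fixes S :: "'a set" and cov :: "'a \<Rightarrow> 'a set \<Rightarrow> bool"
  assumes reflexivity: "\<lbrakk>a \<in> S; U \<subseteq> S; a \<in> U\<rbrakk> \<Longrightarrow> cov a U"
    and transitivity:
      "\<lbrakk>a \<in> S; U \<subseteq> S; V \<subseteq> S; cov a U; sub_cover cov U V\<rbrakk> \<Longrightarrow> cov a V"

definition cover_le ::
    "'a set \<Rightarrow> ('a \<Rightarrow> 'a set \<Rightarrow> bool) \<Rightarrow> ('a \<Rightarrow> 'a set \<Rightarrow> bool) \<Rightarrow> bool" where
  "cover_le S cov cov' \<longleftrightarrow> (\<forall>a\<in>S. \<forall>U. U \<subseteq> S \<longrightarrow> cov a U \<longrightarrow> cov' a U)"

definition saturation :: "'a set \<Rightarrow> ('a \<Rightarrow> 'a set \<Rightarrow> bool) \<Rightarrow> 'a set \<Rightarrow> 'a set" where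
  "saturation S cov U = {a \<in> S. cov a U}"

definition Sat :: "'a set \<Rightarrow> ('a \<Rightarrow> 'a set \<Rightarrow> bool) \<Rightarrow> 'a set set" where
  "Sat S cov = {U. U \<subseteq> S \<and> U = saturation S cov U}"

text \<open>
  Joins and the induced operation are defined directly on saturated subsets, each of which is
  its own saturation.
\<close>

definition sat_join :: "'a set \<Rightarrow> ('a \<Rightarrow> 'a set \<Rightarrow> bool) \<Rightarrow> 'a set set \<Rightarrow> 'a set" where
  "sat_join S cov F = saturation S cov (\<Union>F)"

definition sat_op ::
    "'a set \<Rightarrow> ('a \<Rightarrow> 'a set \<Rightarrow> bool) \<Rightarrow> ('a set \<Rightarrow> 'a set \<Rightarrow> 'a set) \<Rightarrow> 'a set \<Rightarrow> 'a set \<Rightarrow> 'a set" where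
  "sat_op S cov circ X Y = saturation S cov (circ X Y)"

locale convergent_cover = basic_cover S cov
  for S :: "'a set" and cov :: "'a \<Rightarrow> 'a set \<Rightarrow> bool" +
  fixes circ :: "'a set \<Rightarrow> 'a set \<Rightarrow> 'a set"
  assumes circ_closed: "\<lbrakk>U \<subseteq> S; V \<subseteq> S\<rbrakk> \<Longrightarrow> circ U V \<subseteq> S"
    and circ_mono:
      "\<lbrakk>U1 \<subseteq> S; V1 \<subseteq> S; U2 \<subseteq> S; V2 \<subseteq> S; sub_cover cov U1 V1; sub_cover cov U2 V2\<rbrakk>
        \<Longrightarrow> sub_cover cov (circ U1 U2) (circ V1 V2)"
    and circ_assoc:
      "\<lbrakk>U \<subseteq> S; V \<subseteq> S; W \<subseteq> S\<rbrakk> \<Longrightarrow> sub_cover cov (circ (circ U V) W) (circ U (circ V W))"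
    and circ_commute: "\<lbrakk>U \<subseteq> S; V \<subseteq> S\<rbrakk> \<Longrightarrow> sub_cover cov (circ U V) (circ V U)"
    and distrib_left:
      "\<lbrakk>F \<subseteq> Sat S cov; Y \<in> Sat S cov\<rbrakk>
        \<Longrightarrow> sat_op S cov circ (sat_join S cov F) Y
            = sat_join S cov ((\<lambda>X. sat_op S cov circ X Y) ` F)"
    and distrib_right:
      "\<lbrakk>F \<subseteq> Sat S cov; Y \<in> Sat S cov\<rbrakk>
        \<Longrightarrow> sat_op S cov circ Y (sat_join S cov F)
            = sat_join S cov ((\<lambda>X. sat_op S cov circ Y X) ` F)"

locale formal_cover = convergent_cover +
  assumes circ_inter:
    "\<lbrakk>U \<subseteq> S; V \<subseteq> S\<rbrakk>
      \<Longrightarrow> saturation S cov (circ U V) = saturation S cov U \<inter> saturation S cov V"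

locale axiom_set =
  fixes S :: "'a set" and I :: "'a \<Rightarrow> 'i set" and C :: "'a \<Rightarrow> 'i \<Rightarrow> 'a set"
  assumes axiom_closed: "\<lbrakk>a \<in> S; i \<in> I a\<rbrakk> \<Longrightarrow> C a i \<subseteq> S"

inductive gen_cover ::
    "'a set \<Rightarrow> ('a \<Rightarrow> 'i set) \<Rightarrow> ('a \<Rightarrow> 'i \<Rightarrow> 'a set) \<Rightarrow> 'a \<Rightarrow> 'a set \<Rightarrow> bool"
  for S :: "'a set" and I :: "'a \<Rightarrow> 'i set" and C :: "'a \<Rightarrow> 'i \<Rightarrow> 'a set" where
  gen_refl: "\<lbrakk>a \<in> S; U \<subseteq> S; a \<in> U\<rbrakk> \<Longrightarrow> gen_cover S I C a U"
| gen_axiom: "\<lbrakk>a \<in> S; U \<subseteq> S; i \<in> I a; \<forall>b\<in>C a i. gen_cover S I C b U\<rbrakk> \<Longrightarrow> gen_cover S I C a U"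

lemma basic_cover_gen_cover: "basic_cover S (gen_cover S I C)"
proof
  fix a U V
  assume "gen_cover S I C a U" "sub_cover (gen_cover S I C) U V" "V \<subseteq> S"
  then show "gen_cover S I C a V"
    by (induction) (auto simp: sub_cover_def intro: gen_axiom)
qed (auto intro: gen_refl)

lemma gen_cover_contains_axioms:
  assumes "axiom_set S I C" "a \<in> S" "i \<in> I a"
  shows "gen_cover S I C a (C a i)"
proof (rule gen_axiom[where i = i])
  show sub: "C a i \<subseteq> S" using axiom_set.axiom_closed[OF assms] .
  show "a \<in> S" "i \<in> I a" using assms by simp_all
  show "\<forall>b\<in>C a i. gen_cover S I C b (C a i)" using sub by (auto intro: gen_refl)
qed

lemma gen_cover_least:
  assumes "axiom_set S I C" "basic_cover S cov"
    and ax: "\<And>a i. a \<in> S \<Longrightarrow> i \<in> I a \<Longrightarrow> cov a (C a i)"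
  shows "cover_le S (gen_cover S I C) cov"
proof -
  have "cov a U" if "gen_cover S I C a U" for a U
    using that
  proof induction
    case (gen_refl a U)
    then show ?case using basic_cover.reflexivity[OF assms(2)] by blast
  next
    case (gen_axiom a U i)
    then show ?case
      using basic_cover.transitivity[OF assms(2), of a "C a i" U] ax
        axiom_set.axiom_closed[OF assms(1)]
      by (auto simp: sub_cover_def)
  qed
  then show ?thesis by (auto simp: cover_le_def)
qed

definition lift_op :: "('a \<Rightarrow> 'a \<Rightarrow> 'a set) \<Rightarrow> 'a set \<Rightarrow> 'a set \<Rightarrow> 'a set" where
  "lift_op \<delta> U V = (\<Union>a\<in>U. \<Union>b\<in>V. \<delta> a b)"

text \<open>
  Each step of adding axioms is an extension of the index type: the constructors \<open>Base1\<close>,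
  \<open>Base2\<close> and \<open>Base3\<close> embed the old indices, and the others record the parameters
  of the added axioms, with the side conditions in the index sets.
\<close>

datatype ('a, 'i) index1 = Base1 'i | Comm 'a 'a | Assoc 'a 'a 'a
datatype ('a, 'j) index2 = Base2 'j | Localize 'a 'j 'a
datatype ('a, 'k) index3 = Base3 'k | Weaken 'a 'a | Contract

definition J1 ::
    "'a set \<Rightarrow> ('a \<Rightarrow> 'a \<Rightarrow> 'a set) \<Rightarrow> ('a \<Rightarrow> 'i set) \<Rightarrow> 'a \<Rightarrow> ('a, 'i) index1 set" where
  "J1 S \<delta> I a =
     Base1 ` I a
     \<union> {Comm b c | b c. b \<in> S \<and> c \<in> S \<and> a \<in> lift_op \<delta> {b} {c}}
     \<union> {Assoc b c d | b c d. b \<in> S \<and> c \<in> S \<and> d \<in> S \<and> a \<in> lift_op \<delta> (lift_op \<delta> {b} {c}) {d}}"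

primrec D1 ::
    "('a \<Rightarrow> 'a \<Rightarrow> 'a set) \<Rightarrow> ('a \<Rightarrow> 'i \<Rightarrow> 'a set) \<Rightarrow> 'a \<Rightarrow> ('a, 'i) index1 \<Rightarrow> 'a set" where
  "D1 \<delta> C a (Base1 i) = C a i"
| "D1 \<delta> C a (Comm b c) = lift_op \<delta> {c} {b}"
| "D1 \<delta> C a (Assoc b c d) = lift_op \<delta> {b} (lift_op \<delta> {c} {d})"

definition J2 ::
    "'a set \<Rightarrow> ('a \<Rightarrow> 'a \<Rightarrow> 'a set) \<Rightarrow> ('a \<Rightarrow> 'j set) \<Rightarrow> 'a \<Rightarrow> ('a, 'j) index2 set" where
  "J2 S \<delta> J a =
     Base2 ` J a
     \<union> {Localize b j c | b j c. b \<in> S \<and> c \<in> S \<and> j \<in> J b \<and> a \<in> lift_op \<delta> {b} {c}}"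

primrec D2 ::
    "('a \<Rightarrow> 'a \<Rightarrow> 'a set) \<Rightarrow> ('a \<Rightarrow> 'j \<Rightarrow> 'a set) \<Rightarrow> 'a \<Rightarrow> ('a, 'j) index2 \<Rightarrow> 'a set" where
  "D2 \<delta> D a (Base2 j) = D a j"
| "D2 \<delta> D a (Localize b j c) = lift_op \<delta> (D b j) {c}"

definition J3 ::
    "'a set \<Rightarrow> ('a \<Rightarrow> 'a \<Rightarrow> 'a set) \<Rightarrow> ('a \<Rightarrow> 'k set) \<Rightarrow> 'a \<Rightarrow> ('a, 'k) index3 set" where
  "J3 S \<delta> K a =
     Base3 ` K a
     \<union> {Weaken b c | b c. b \<in> S \<and> c \<in> S \<and> a \<in> lift_op \<delta> {b} {c}}
     \<union> {Contract}"

primrec D3 ::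
    "('a \<Rightarrow> 'a \<Rightarrow> 'a set) \<Rightarrow> ('a \<Rightarrow> 'k \<Rightarrow> 'a set) \<Rightarrow> 'a \<Rightarrow> ('a, 'k) index3 \<Rightarrow> 'a set" where
  "D3 \<delta> E a (Base3 k) = E a k"
| "D3 \<delta> E a (Weaken b c) = {c}"
| "D3 \<delta> E a Contract = lift_op \<delta> {a} {a}"

definition formal_gen_cover ::
    "'a set \<Rightarrow> ('a \<Rightarrow> 'i set) \<Rightarrow> ('a \<Rightarrow> 'i \<Rightarrow> 'a set) \<Rightarrow> ('a \<Rightarrow> 'a \<Rightarrow> 'a set)
      \<Rightarrow> 'a \<Rightarrow> 'a set \<Rightarrow> bool" where
  "formal_gen_cover S I C \<delta> =
     gen_cover S (J3 S \<delta> (J2 S \<delta> (J1 S \<delta> I))) (D3 \<delta> (D2 \<delta> (D1 \<delta> C)))"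

end

theory Submission
  imports Defs
begin

text \<open>
  In a formal cover the operation is forced to be the meet of saturated sets, so the axioms
  added to \<open>(I, C)\<close> are the ones that hold as soon as \<open>\<delta> a b\<close> presents the meet of \<open>a\<close>
  and \<open>b\<close>. This gives minimality: distributivity extends the identity
  \<open>\<A>'(\<delta> a b) = \<A>'{a} \<inter> \<A>'{b}\<close> from elements to arbitrary subsets
  (\<open>saturation_lift_op\<close>), and then each added axiom is a trivial fact about intersections.

  That the generated cover is formal comes down to stability, \<open>b \<lhd> U \<Longrightarrow> b \<circ> c \<lhd> U \<circ> c\<close>
  (\<open>stable\<close>), since monotonicity in both arguments follows from it by commutativity. It is
  proved by induction on the derivation of \<open>b \<lhd> U\<close>. Only the axioms of \<open>(J, D)\<close> are stable
  by fiat; the others are stable for the following reasons, in which associativity is used in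
  both directions (the reverse direction follows from commutativity).

  \<^item> A localised axiom \<open>b \<lhd> D(d,j) \<circ> e\<close> with \<open>b \<in> d \<circ> e\<close>: move \<open>c\<close> inwards,
    \<open>(d \<circ> e) \<circ> c \<lhd> d \<circ> (e \<circ> c)\<close>, localise the original axiom at the elements of
    \<open>e \<circ> c\<close>, and move \<open>c\<close> back out.
  \<^item> A weakening \<open>b \<lhd> {e}\<close> with \<open>b \<in> d \<circ> e\<close>:
    \<open>(d \<circ> e) \<circ> c \<lhd> d \<circ> (e \<circ> c) \<lhd> e \<circ> c\<close>, the last step again by weakening.
  \<^item> A contraction \<open>b \<lhd> b \<circ> b\<close>: an element \<open>a \<in> b \<circ> c\<close> contracts to \<open>a \<circ> a\<close>;
    weakening the first factor to \<open>b\<close> gives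
    \<open>a \<circ> a \<lhd> b \<circ> a \<subseteq> b \<circ> (b \<circ> c) \<lhd> (b \<circ> b) \<circ> c\<close>.

  Weakening and contraction then turn stability into
  \<open>\<A>(U \<circ> V) = \<A> U \<inter> \<A> V\<close>, and distributivity holds because \<open>\<circ>\<close> is defined
  elementwise.
\<close>

section \<open>Saturation as a closure operator\<close>

lemma sub_cover_iff_subset_saturation:
  "U \<subseteq> S \<Longrightarrow> sub_cover cov U V \<longleftrightarrow> U \<subseteq> saturation S cov V"
  by (auto simp: sub_cover_def saturation_def)

context basic_cover
begin

lemma saturation_closed: "saturation S cov U \<subseteq> S"
  by (auto simp: saturation_def)

lemma saturation_extensive: "U \<subseteq> S \<Longrightarrow> U \<subseteq> saturation S cov U"
  by (auto simp: saturation_def intro: reflexivity)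

lemma saturation_least:
  "U \<subseteq> S \<Longrightarrow> V \<subseteq> S \<Longrightarrow> U \<subseteq> saturation S cov V \<Longrightarrow> saturation S cov U \<subseteq> saturation S cov V"
  using transitivity[of _ U V] by (fastforce simp: saturation_def sub_cover_def)

lemma saturation_mono:
  "U \<subseteq> V \<Longrightarrow> V \<subseteq> S \<Longrightarrow> saturation S cov U \<subseteq> saturation S cov V"
  using saturation_least[of U V] saturation_extensive[of V] by blast

lemma saturation_idem:
  "U \<subseteq> S \<Longrightarrow> saturation S cov (saturation S cov U) = saturation S cov U"
  using saturation_least[of "saturation S cov U" U] saturation_closed[of U]
    saturation_extensive[of "saturation S cov U"]
  by blast

lemma saturation_in_Sat: "U \<subseteq> S \<Longrightarrow> saturation S cov U \<in> Sat S cov"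
  by (simp add: Sat_def saturation_closed saturation_idem)

lemma sub_cover_refl: "U \<subseteq> V \<Longrightarrow> V \<subseteq> S \<Longrightarrow> sub_cover cov U V"
  by (auto simp: sub_cover_def intro: reflexivity)

lemma sub_cover_trans [trans]:
  "sub_cover cov U V \<Longrightarrow> sub_cover cov V W \<Longrightarrow> U \<subseteq> S \<Longrightarrow> V \<subseteq> S \<Longrightarrow> W \<subseteq> S \<Longrightarrow> sub_cover cov U W"
  unfolding sub_cover_def using transitivity[of _ V W] by (auto simp: sub_cover_def)

end

section \<open>Operations defined elementwise\<close>

lemma in_lift_op_iff: "x \<in> lift_op \<delta> U V \<longleftrightarrow> (\<exists>a\<in>U. \<exists>b\<in>V. x \<in> \<delta> a b)"
  by (auto simp: lift_op_def)

lemma lift_op_singletons [simp]: "lift_op \<delta> {a} {b} = \<delta> a b"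
  by (simp add: lift_op_def)

lemma lift_op_mono: "U \<subseteq> U' \<Longrightarrow> V \<subseteq> V' \<Longrightarrow> lift_op \<delta> U V \<subseteq> lift_op \<delta> U' V'"
  by (auto simp: lift_op_def)

lemma lift_op_closed:
  assumes "\<And>a b. a \<in> S \<Longrightarrow> b \<in> S \<Longrightarrow> \<delta> a b \<subseteq> S" "U \<subseteq> S" "V \<subseteq> S"
  shows "lift_op \<delta> U V \<subseteq> S"
  using assms by (fastforce simp: lift_op_def)

section \<open>Formal covers extending a given map\<close>

context formal_cover
begin

text \<open>
  Distributivity of \<open>\<circ>\<close> becomes the frame law, because \<open>\<circ>\<close> induces intersection on
  saturated subsets and every saturated set is the join of the saturations of its elements.
\<close>

lemma saturation_inter_subset:
  assumes "U \<subseteq> S" "Y \<in> Sat S cov"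
  shows "saturation S cov U \<inter> Y \<subseteq> saturation S cov (\<Union>a\<in>U. saturation S cov {a} \<inter> Y)"
proof -
  let ?F = "(\<lambda>a. saturation S cov {a}) ` U"
  have Y: "Y \<subseteq> S" "saturation S cov Y = Y"
    using assms(2) by (auto simp: Sat_def)
  have op: "sat_op S cov circ X Y = X \<inter> Y" if "X \<in> Sat S cov" for X
    using that Y circ_inter[of X Y] by (auto simp: sat_op_def Sat_def)
  have F: "?F \<subseteq> Sat S cov"
    using assms(1) by (auto intro!: saturation_in_Sat)
  have FS: "\<Union>?F \<subseteq> S"
    using saturation_closed by blast
  have "U \<subseteq> \<Union>?F"
  proof
    fix a assume "a \<in> U"
    then show "a \<in> \<Union>?F"
      using assms(1) saturation_extensive[of "{a}"] by auto
  qed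
  then have "saturation S cov U \<inter> Y \<subseteq> sat_join S cov ?F \<inter> Y"
    using saturation_mono[OF _ FS] by (auto simp: sat_join_def)
  also have "\<dots> = sat_op S cov circ (sat_join S cov ?F) Y"
    using FS by (simp add: op sat_join_def saturation_in_Sat)
  also have "\<dots> = sat_join S cov ((\<lambda>X. sat_op S cov circ X Y) ` ?F)"
    using F assms(2) by (rule distrib_left)
  also have "(\<lambda>X. sat_op S cov circ X Y) ` ?F = (\<lambda>a. saturation S cov {a} \<inter> Y) ` U"
    unfolding image_image using F by (intro image_cong op) auto
  finally show ?thesis
    by (simp add: sat_join_def)
qed

text \<open>
  An operation prescribed up to saturation on elements is determined up to saturation on all
  subsets, by applying the frame law once in each argument.
\<close>

lemma saturation_lift_op:
  assumes closed: "\<And>a b. a \<in> S \<Longrightarrow> b \<in> S \<Longrightarrow> \<delta> a b \<subseteq> S"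
    and ext: "\<And>a b. a \<in> S \<Longrightarrow> b \<in> S \<Longrightarrow>
      saturation S cov (circ {a} {b}) = saturation S cov (\<delta> a b)"
    and U: "U \<subseteq> S" and V: "V \<subseteq> S"
  shows "saturation S cov (lift_op \<delta> U V) = saturation S cov U \<inter> saturation S cov V"
proof
  let ?A = "saturation S cov"
  have UV: "lift_op \<delta> U V \<subseteq> S"
    using closed U V by (rule lift_op_closed)
  have meet: "?A (\<delta> a b) = ?A {a} \<inter> ?A {b}" if "a \<in> S" "b \<in> S" for a b
    using that ext[of a b] circ_inter[of "{a}" "{b}"] by simp
  show "?A (lift_op \<delta> U V) \<subseteq> ?A U \<inter> ?A V"
  proof -
    have "\<delta> a b \<subseteq> ?A U \<inter> ?A V" if "a \<in> U" "b \<in> V" for a b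
    proof -
      have "a \<in> S" "b \<in> S" using that U V by auto
      then have "\<delta> a b \<subseteq> ?A {a} \<inter> ?A {b}"
        using saturation_extensive[OF closed] meet by blast
      also have "\<dots> \<subseteq> ?A U \<inter> ?A V"
        using that U V saturation_mono[of "{a}" U] saturation_mono[of "{b}" V] by blast
      finally show ?thesis .
    qed
    then have "lift_op \<delta> U V \<subseteq> ?A U \<inter> ?A V"
      by (fastforce simp: in_lift_op_iff)
    then show ?thesis
      using saturation_least[OF UV U] saturation_least[OF UV V] by blast
  qed
  show "?A U \<inter> ?A V \<subseteq> ?A (lift_op \<delta> U V)"
  proof -
    have "?A {a} \<inter> ?A V \<subseteq> ?A (lift_op \<delta> U V)" if a: "a \<in> U" for a
    proof -
      have aS: "{a} \<subseteq> S" "a \<in> S" using a U by auto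
      have "?A V \<inter> ?A {a} \<subseteq> ?A (\<Union>b\<in>V. ?A {b} \<inter> ?A {a})"
        using V saturation_in_Sat[OF aS(1)] by (rule saturation_inter_subset)
      moreover have "?A {b} \<inter> ?A {a} \<subseteq> ?A (lift_op \<delta> U V)" if "b \<in> V" for b
      proof -
        have "\<delta> a b \<subseteq> lift_op \<delta> U V" using a that by (auto simp: lift_op_def)
        from saturation_mono[OF this UV] show ?thesis
          using meet[of a b] aS that V by blast
      qed
      then have "?A (\<Union>b\<in>V. ?A {b} \<inter> ?A {a}) \<subseteq> ?A (lift_op \<delta> U V)"
        using saturation_closed UV by (intro saturation_least) blast+
      ultimately show ?thesis by blast
    qed
    then have "?A (\<Union>a\<in>U. ?A {a} \<inter> ?A V) \<subseteq> ?A (lift_op \<delta> U V)"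
      using saturation_closed UV by (intro saturation_least) blast+
    with saturation_inter_subset[OF U saturation_in_Sat[OF V]] show ?thesis
      by blast
  qed
qed

end

section \<open>The generated cover\<close>

locale axiom_set_with_operation = axiom_set S I C
  for S :: "'a set" and I :: "'a \<Rightarrow> 'i set" and C :: "'a \<Rightarrow> 'i \<Rightarrow> 'a set" +
  fixes \<delta> :: "'a \<Rightarrow> 'a \<Rightarrow> 'a set"
  assumes \<delta>_closed: "\<And>a b. a \<in> S \<Longrightarrow> b \<in> S \<Longrightarrow> \<delta> a b \<subseteq> S"
begin

abbreviation cov :: "'a \<Rightarrow> 'a set \<Rightarrow> bool" where
  "cov \<equiv> formal_gen_cover S I C \<delta>"

abbreviation op :: "'a set \<Rightarrow> 'a set \<Rightarrow> 'a set" (infixl "\<odot>" 70) where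
  "U \<odot> V \<equiv> lift_op \<delta> U V"

abbreviation J :: "'a \<Rightarrow> ('a, 'i) index1 set" where
  "J \<equiv> J1 S \<delta> I"

abbreviation D :: "'a \<Rightarrow> ('a, 'i) index1 \<Rightarrow> 'a set" where
  "D \<equiv> D1 \<delta> C"

lemma op_closed: "U \<subseteq> S \<Longrightarrow> V \<subseteq> S \<Longrightarrow> U \<odot> V \<subseteq> S"
  using lift_op_closed[of S \<delta>] \<delta>_closed by blast

lemma D_closed: "a \<in> S \<Longrightarrow> j \<in> J a \<Longrightarrow> D a j \<subseteq> S"
  by (auto simp: J1_def axiom_closed \<delta>_closed op_closed del: subsetI)

lemma axiom_set_J2: "axiom_set S (J2 S \<delta> J) (D2 \<delta> D)"
  by unfold_locales (auto simp: J2_def D_closed op_closed del: subsetI)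

lemma axiom_set_J3: "axiom_set S (J3 S \<delta> (J2 S \<delta> J)) (D3 \<delta> (D2 \<delta> D))"
  by unfold_locales
    (auto simp: J3_def axiom_set.axiom_closed[OF axiom_set_J2] \<delta>_closed del: subsetI)

sublocale cov: basic_cover S cov
  unfolding formal_gen_cover_def by (rule basic_cover_gen_cover)

lemma cov_axiom:
  "a \<in> S \<Longrightarrow> k \<in> J3 S \<delta> (J2 S \<delta> J) a \<Longrightarrow> cov a (D3 \<delta> (D2 \<delta> D) a k)"
  unfolding formal_gen_cover_def by (rule gen_cover_contains_axioms[OF axiom_set_J3])

lemma cov_base: "a \<in> S \<Longrightarrow> j \<in> J a \<Longrightarrow> cov a (D a j)"
  using cov_axiom[of a "Base3 (Base2 j)"] by (simp add: J3_def J2_def)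

lemma cov_comm: "b \<in> S \<Longrightarrow> c \<in> S \<Longrightarrow> a \<in> \<delta> b c \<Longrightarrow> cov a (\<delta> c b)"
  using cov_base[of a "Comm b c"] \<delta>_closed by (auto simp: J1_def)

lemma cov_assoc:
  "b \<in> S \<Longrightarrow> c \<in> S \<Longrightarrow> d \<in> S \<Longrightarrow> a \<in> ({b} \<odot> {c}) \<odot> {d} \<Longrightarrow> cov a ({b} \<odot> ({c} \<odot> {d}))"
  using cov_base[of a "Assoc b c d"] op_closed[of "{b} \<odot> {c}" "{d}"] \<delta>_closed
  by (auto simp: J1_def)

lemma cov_localize:
  "b \<in> S \<Longrightarrow> c \<in> S \<Longrightarrow> j \<in> J b \<Longrightarrow> a \<in> \<delta> b c \<Longrightarrow> cov a (D b j \<odot> {c})"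
  using cov_axiom[of a "Base3 (Localize b j c)"] \<delta>_closed by (auto simp: J3_def J2_def)

lemma cov_weaken: "b \<in> S \<Longrightarrow> c \<in> S \<Longrightarrow> a \<in> \<delta> b c \<Longrightarrow> cov a {c}"
  using cov_axiom[of a "Weaken b c"] \<delta>_closed by (auto simp: J3_def)

lemma cov_contract: "a \<in> S \<Longrightarrow> cov a ({a} \<odot> {a})"
  using cov_axiom[of a Contract] by (simp add: J3_def)

text \<open>
  Induction on derivations, with one case for each kind of axiom that calls for its own
  argument; the axioms of \<open>(J, D)\<close>, which are all localised, share the case \<open>base\<close>.
\<close>

lemma cov_induct [consumes 1, case_names refl base localize weaken contract]:
  assumes "cov a U"
    and "\<And>a U. U \<subseteq> S \<Longrightarrow> a \<in> U \<Longrightarrow> P a U"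
    and "\<And>a U j. a \<in> S \<Longrightarrow> U \<subseteq> S \<Longrightarrow> j \<in> J a \<Longrightarrow> (\<And>b. b \<in> D a j \<Longrightarrow> P b U) \<Longrightarrow> P a U"
    and "\<And>a U d j e. U \<subseteq> S \<Longrightarrow> d \<in> S \<Longrightarrow> e \<in> S \<Longrightarrow> j \<in> J d \<Longrightarrow> a \<in> \<delta> d e \<Longrightarrow>
      (\<And>b. b \<in> D d j \<odot> {e} \<Longrightarrow> P b U) \<Longrightarrow> P a U"
    and "\<And>a U d e. U \<subseteq> S \<Longrightarrow> d \<in> S \<Longrightarrow> e \<in> S \<Longrightarrow> a \<in> \<delta> d e \<Longrightarrow> P e U \<Longrightarrow> P a U"
    and "\<And>a U. a \<in> S \<Longrightarrow> U \<subseteq> S \<Longrightarrow> (\<And>b. b \<in> {a} \<odot> {a} \<Longrightarrow> P b U) \<Longrightarrow> P a U"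
  shows "P a U"
  using assms(1) unfolding formal_gen_cover_def
proof (induction rule: gen_cover.induct)
  case (gen_refl a U)
  then show ?case using assms(2) by blast
next
  case (gen_axiom a U k)
  from gen_axiom.hyps(3) consider
      j where "k = Base3 (Base2 j)" "j \<in> J a"
    | d j e where "k = Base3 (Localize d j e)" "d \<in> S" "e \<in> S" "j \<in> J d" "a \<in> \<delta> d e"
    | d e where "k = Weaken d e" "d \<in> S" "e \<in> S" "a \<in> \<delta> d e"
    | "k = Contract"
    by (auto simp: J3_def J2_def)
  then show ?case
  proof cases
    case 1
    then show ?thesis using gen_axiom assms(3)[of a U j] by simp
  next
    case 2
    then show ?thesis using gen_axiom assms(4)[of U d e j a] by simp
  next
    case 3
    then show ?thesis using gen_axiom assms(5)[of U d e a] by simp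
  next
    case 4
    then show ?thesis using gen_axiom assms(6)[of a U] by simp
  qed
qed

subsection \<open>Structural rules for subsets\<close>

lemma sub_cover_op:
  assumes "W \<subseteq> S" "\<And>a b. a \<in> U \<Longrightarrow> b \<in> V \<Longrightarrow> sub_cover cov ({a} \<odot> {b}) W"
  shows "sub_cover cov (U \<odot> V) W"
  using assms by (fastforce simp: sub_cover_def in_lift_op_iff)

lemma cov_mono: "cov a U \<Longrightarrow> a \<in> S \<Longrightarrow> U \<subseteq> V \<Longrightarrow> V \<subseteq> S \<Longrightarrow> cov a V"
  using cov.saturation_mono[of U V] by (auto simp: saturation_def)

lemma op_comm:
  assumes "U \<subseteq> S" "V \<subseteq> S"
  shows "sub_cover cov (U \<odot> V) (V \<odot> U)"
  unfolding sub_cover_def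
proof
  fix x assume "x \<in> U \<odot> V"
  then obtain u v where uv: "u \<in> U" "v \<in> V" "x \<in> \<delta> u v"
    by (auto simp: in_lift_op_iff)
  then have S: "u \<in> S" "v \<in> S" using assms by auto
  have "cov x (\<delta> v u)" by (rule cov_comm[OF S uv(3)])
  moreover have "x \<in> S" using \<delta>_closed[OF S] uv(3) by (rule subsetD)
  moreover have "\<delta> v u \<subseteq> V \<odot> U" using uv by (auto simp: lift_op_def)
  moreover have "V \<odot> U \<subseteq> S" by (intro op_closed assms)
  ultimately show "cov x (V \<odot> U)" by (rule cov_mono)
qed

lemma op_assoc:
  assumes "U \<subseteq> S" "V \<subseteq> S" "W \<subseteq> S"
  shows "sub_cover cov (U \<odot> V \<odot> W) (U \<odot> (V \<odot> W))"
  unfolding sub_cover_def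
proof
  fix x assume x: "x \<in> U \<odot> V \<odot> W"
  then obtain y w where w: "w \<in> W" "y \<in> U \<odot> V" "x \<in> \<delta> y w"
    by (auto simp: in_lift_op_iff)
  then obtain u v where "u \<in> U" "v \<in> V" "y \<in> \<delta> u v"
    by (auto simp: in_lift_op_iff)
  with w have uvw: "u \<in> U" "v \<in> V" "w \<in> W" "x \<in> {u} \<odot> {v} \<odot> {w}"
    by (auto simp: in_lift_op_iff)
  from uvw have "cov x ({u} \<odot> ({v} \<odot> {w}))" using assms by (intro cov_assoc) auto
  moreover have "x \<in> S"
    by (rule subsetD[OF _ x]) (intro op_closed assms)
  moreover have "{u} \<odot> ({v} \<odot> {w}) \<subseteq> U \<odot> (V \<odot> W)"
    using uvw by (intro lift_op_mono) auto
  moreover have "U \<odot> (V \<odot> W) \<subseteq> S" by (intro op_closed assms)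
  ultimately show "cov x (U \<odot> (V \<odot> W))" by (rule cov_mono)
qed

text \<open>
  Commutativity is only ever applied to the outermost operation here, so that no monotonicity
  of \<open>\<odot>\<close> is required; this is what makes the lemma available in the proof of stability.
\<close>

lemma op_assoc_reverse:
  assumes "U \<subseteq> S" "V \<subseteq> S" "W \<subseteq> S"
  shows "sub_cover cov (U \<odot> (V \<odot> W)) (U \<odot> V \<odot> W)"
proof -
  note closed = assms op_closed
  have "sub_cover cov (U \<odot> (V \<odot> W)) (V \<odot> W \<odot> U)"
    by (intro op_comm closed)
  also have "sub_cover cov (V \<odot> W \<odot> U) (V \<odot> (W \<odot> U))"
    by (intro op_assoc closed)
  also have "sub_cover cov (V \<odot> (W \<odot> U)) (W \<odot> U \<odot> V)"
    by (intro op_comm closed)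
  also have "sub_cover cov (W \<odot> U \<odot> V) (W \<odot> (U \<odot> V))"
    by (intro op_assoc closed)
  also have "sub_cover cov (W \<odot> (U \<odot> V)) (U \<odot> V \<odot> W)"
    by (intro op_comm closed)
  finally show ?thesis by (simp add: closed)
qed

lemma op_weaken:
  assumes "U \<subseteq> S" "V \<subseteq> S"
  shows "sub_cover cov (U \<odot> V) V"
  unfolding sub_cover_def
proof
  fix x assume "x \<in> U \<odot> V"
  then obtain u v where uv: "u \<in> U" "v \<in> V" "x \<in> \<delta> u v"
    by (auto simp: in_lift_op_iff)
  then have S: "u \<in> S" "v \<in> S" using assms by auto
  have "cov x {v}" by (rule cov_weaken[OF S uv(3)])
  moreover have "x \<in> S" using \<delta>_closed[OF S] uv(3) by (rule subsetD)
  moreover have "{v} \<subseteq> V" using uv by simp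
  ultimately show "cov x V" using assms(2) by (rule cov_mono)
qed

lemma op_localize:
  assumes "b \<in> S" "j \<in> J b" "W \<subseteq> S"
  shows "sub_cover cov ({b} \<odot> W) (D b j \<odot> W)"
  unfolding sub_cover_def
proof
  fix x assume "x \<in> {b} \<odot> W"
  then obtain w where w: "w \<in> W" "x \<in> \<delta> b w"
    by (auto simp: in_lift_op_iff)
  then have wS: "w \<in> S" using assms by auto
  have "cov x (D b j \<odot> {w})" by (rule cov_localize[OF assms(1) wS assms(2) w(2)])
  moreover have "x \<in> S" using \<delta>_closed[OF assms(1) wS] w(2) by (rule subsetD)
  moreover have "D b j \<odot> {w} \<subseteq> D b j \<odot> W" using w by (intro lift_op_mono) auto
  moreover have "D b j \<odot> W \<subseteq> S" by (intro op_closed D_closed assms)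
  ultimately show "cov x (D b j \<odot> W)" by (rule cov_mono)
qed

subsection \<open>Stability\<close>

text \<open>
  A weakening to the left factor can be used inside a further operation: it is a commutation,
  whose axiom is localised, followed by a weakening to the right factor, which may be postponed
  by associativity.
\<close>

lemma op_weaken_left_factor:
  assumes "b \<in> S" "c \<in> S" "a \<in> \<delta> b c" "W \<subseteq> S"
  shows "sub_cover cov ({a} \<odot> W) ({b} \<odot> W)"
proof -
  have a: "a \<in> S" using assms \<delta>_closed by blast
  have S: "{a} \<subseteq> S" "{b} \<subseteq> S" "{c} \<subseteq> S" using a assms by auto
  note closed = S assms(4) op_closed
  have "Comm b c \<in> J a" using assms by (auto simp: J1_def)
  from op_localize[OF a this assms(4)]
  have "sub_cover cov ({a} \<odot> W) ({c} \<odot> {b} \<odot> W)" by simp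
  also have "sub_cover cov ({c} \<odot> {b} \<odot> W) ({c} \<odot> ({b} \<odot> W))"
    by (intro op_assoc closed)
  also have "sub_cover cov ({c} \<odot> ({b} \<odot> W)) ({b} \<odot> W)"
    by (intro op_weaken closed)
  finally show ?thesis by (simp only: closed)
qed

text \<open>
  If \<open>b \<lhd> X\<close> is the axiom with which the derivation of \<open>b \<lhd> U\<close> ends, then by the induction
  hypotheses it suffices to show \<open>{b} \<odot> {c} \<lhd> X \<odot> {c}\<close>. So each case checks that one kind of
  axiom is stable.
\<close>

lemma stable:
  assumes "cov b U" "b \<in> S" "c \<in> S"
  shows "sub_cover cov ({b} \<odot> {c}) (U \<odot> {c})"
  using assms(1,2)
proof (induction rule: cov_induct)
  case (refl b U)
  then show ?case
    using assms(3) by (intro cov.sub_cover_refl lift_op_mono op_closed) auto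
next
  case (base b U j)
  note D = D_closed[OF base.hyps(1,3)]
  have S: "{b} \<subseteq> S" "{c} \<subseteq> S" using base.hyps assms(3) by auto
  note closed = S D base.hyps(2) op_closed
  have "sub_cover cov ({b} \<odot> {c}) (D b j \<odot> {c})"
    by (intro op_localize base.hyps S)
  also have "sub_cover cov (D b j \<odot> {c}) (U \<odot> {c})"
  proof (rule sub_cover_op)
    show "U \<odot> {c} \<subseteq> S" by (intro closed)
    show "sub_cover cov ({x} \<odot> {y}) (U \<odot> {c})" if "x \<in> D b j" "y \<in> {c}" for x y
      using that base.IH D by auto
  qed
  finally show ?case by (simp only: closed)
next
  case (localize b U d j e)
  note D = D_closed[OF localize.hyps(2,4)]
  have S: "{b} \<subseteq> S" "{c} \<subseteq> S" "{d} \<subseteq> S" "{e} \<subseteq> S"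
    using localize.hyps localize.prems assms(3) by auto
  note closed = S D localize.hyps(1) op_closed
  have "sub_cover cov ({b} \<odot> {c}) ({d} \<odot> {e} \<odot> {c})"
    using localize.hyps by (intro cov.sub_cover_refl lift_op_mono closed) auto
  also have "sub_cover cov ({d} \<odot> {e} \<odot> {c}) ({d} \<odot> ({e} \<odot> {c}))"
    by (intro op_assoc closed)
  also have "sub_cover cov ({d} \<odot> ({e} \<odot> {c})) (D d j \<odot> ({e} \<odot> {c}))"
    by (intro op_localize closed localize.hyps)
  also have "sub_cover cov (D d j \<odot> ({e} \<odot> {c})) (D d j \<odot> {e} \<odot> {c})"
    by (intro op_assoc_reverse closed)
  also have "sub_cover cov (D d j \<odot> {e} \<odot> {c}) (U \<odot> {c})"
  proof (rule sub_cover_op)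
    show "U \<odot> {c} \<subseteq> S" by (intro closed)
    show "sub_cover cov ({x} \<odot> {y}) (U \<odot> {c})" if "x \<in> D d j \<odot> {e}" "y \<in> {c}" for x y
      using that localize.IH op_closed[OF D S(4)] by auto
  qed
  finally show ?case by (simp only: closed)
next
  case (weaken b U d e)
  have S: "{b} \<subseteq> S" "{c} \<subseteq> S" "{d} \<subseteq> S" "{e} \<subseteq> S"
    using weaken.hyps weaken.prems assms(3) by auto
  note closed = S weaken.hyps(1) op_closed
  have "sub_cover cov ({b} \<odot> {c}) ({d} \<odot> {e} \<odot> {c})"
    using weaken.hyps by (intro cov.sub_cover_refl lift_op_mono closed) auto
  also have "sub_cover cov ({d} \<odot> {e} \<odot> {c}) ({d} \<odot> ({e} \<odot> {c}))"
    by (intro op_assoc closed)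
  also have "sub_cover cov ({d} \<odot> ({e} \<odot> {c})) ({e} \<odot> {c})"
    by (intro op_weaken closed)
  also have "sub_cover cov ({e} \<odot> {c}) (U \<odot> {c})"
    by (intro weaken.IH weaken.hyps)
  finally show ?case by (simp only: closed)
next
  case (contract b U)
  have S: "{b} \<subseteq> S" "{c} \<subseteq> S" using contract.hyps assms(3) by auto
  note closed = S contract.hyps(2) op_closed
  have "cov a ({b} \<odot> ({b} \<odot> {c}))" if a: "a \<in> \<delta> b c" for a
  proof -
    have aS: "a \<in> S" "{a} \<subseteq> S" using a S \<delta>_closed[of b c] by auto
    have "sub_cover cov {a} ({a} \<odot> {a})"
      using cov_contract[OF aS(1)] by (simp add: sub_cover_def)
    also have "sub_cover cov ({a} \<odot> {a}) ({b} \<odot> {a})"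
      using a S aS by (intro op_weaken_left_factor[of b c]) auto
    also have "sub_cover cov ({b} \<odot> {a}) ({b} \<odot> ({b} \<odot> {c}))"
      using a by (intro cov.sub_cover_refl lift_op_mono closed) auto
    finally have "sub_cover cov {a} ({b} \<odot> ({b} \<odot> {c}))"
      by (simp only: closed aS)
    then show ?thesis by (simp add: sub_cover_def)
  qed
  then have "sub_cover cov ({b} \<odot> {c}) ({b} \<odot> ({b} \<odot> {c}))"
    by (simp add: sub_cover_def)
  also have "sub_cover cov ({b} \<odot> ({b} \<odot> {c})) ({b} \<odot> {b} \<odot> {c})"
    by (intro op_assoc_reverse closed)
  also have "sub_cover cov ({b} \<odot> {b} \<odot> {c}) (U \<odot> {c})"
  proof (rule sub_cover_op)
    show "U \<odot> {c} \<subseteq> S" by (intro closed)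
    show "sub_cover cov ({x} \<odot> {y}) (U \<odot> {c})" if "x \<in> {b} \<odot> {b}" "y \<in> {c}" for x y
      using that contract.IH op_closed[OF S(1) S(1)] by auto
  qed
  finally show ?case by (simp only: closed)
qed

lemma op_mono_left:
  assumes "U \<subseteq> S" "V \<subseteq> S" "W \<subseteq> S" "sub_cover cov U V"
  shows "sub_cover cov (U \<odot> W) (V \<odot> W)"
proof (rule sub_cover_op)
  show "V \<odot> W \<subseteq> S" by (intro op_closed assms)
  fix u w assume uw: "u \<in> U" "w \<in> W"
  then have S: "{u} \<subseteq> S" "{w} \<subseteq> S" "u \<in> S" "w \<in> S" using assms by auto
  note closed = S assms op_closed
  have "sub_cover cov ({u} \<odot> {w}) (V \<odot> {w})"
    using assms(4) uw S by (intro stable) (auto simp: sub_cover_def)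
  also have "sub_cover cov (V \<odot> {w}) (V \<odot> W)"
    using uw by (intro cov.sub_cover_refl lift_op_mono closed) auto
  finally show "sub_cover cov ({u} \<odot> {w}) (V \<odot> W)" by (simp only: closed)
qed

lemma op_mono:
  assumes "U1 \<subseteq> S" "V1 \<subseteq> S" "U2 \<subseteq> S" "V2 \<subseteq> S" "sub_cover cov U1 V1" "sub_cover cov U2 V2"
  shows "sub_cover cov (U1 \<odot> U2) (V1 \<odot> V2)"
proof -
  note closed = assms op_closed
  have "sub_cover cov (U1 \<odot> U2) (V1 \<odot> U2)"
    by (intro op_mono_left closed)
  also have "sub_cover cov (V1 \<odot> U2) (U2 \<odot> V1)"
    by (intro op_comm closed)
  also have "sub_cover cov (U2 \<odot> V1) (V2 \<odot> V1)"
    by (intro op_mono_left closed)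
  also have "sub_cover cov (V2 \<odot> V1) (V1 \<odot> V2)"
    by (intro op_comm closed)
  finally show ?thesis by (simp only: closed)
qed

subsection \<open>The generated cover is formal\<close>

lemma saturation_op:
  assumes "U \<subseteq> S" "V \<subseteq> S"
  shows "saturation S cov (U \<odot> V) = saturation S cov U \<inter> saturation S cov V"
proof
  note UV = op_closed[OF assms]
  have "sub_cover cov (U \<odot> V) V"
    by (rule op_weaken[OF assms])
  moreover have "sub_cover cov (U \<odot> V) U"
    using op_comm[OF assms] op_weaken[OF assms(2,1)] UV op_closed[OF assms(2,1)] assms(1)
    by (rule cov.sub_cover_trans)
  ultimately have "U \<odot> V \<subseteq> saturation S cov U" "U \<odot> V \<subseteq> saturation S cov V"
    using UV by (simp_all add: sub_cover_iff_subset_saturation[symmetric])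
  then show "saturation S cov (U \<odot> V) \<subseteq> saturation S cov U \<inter> saturation S cov V"
    using assms UV by (simp add: cov.saturation_least)
  show "saturation S cov U \<inter> saturation S cov V \<subseteq> saturation S cov (U \<odot> V)"
  proof
    fix x assume "x \<in> saturation S cov U \<inter> saturation S cov V"
    then have x: "x \<in> S" "{x} \<subseteq> S" "sub_cover cov {x} U" "sub_cover cov {x} V"
      by (auto simp: saturation_def sub_cover_def)
    have "sub_cover cov ({x} \<odot> {x}) (U \<odot> V)"
      using x assms by (intro op_mono)
    with cov_contract[OF x(1)] have "cov x (U \<odot> V)"
      using x assms UV op_closed[of "{x}" "{x}"] by (blast intro: cov.transitivity)
    with x show "x \<in> saturation S cov (U \<odot> V)"
      by (simp add: saturation_def)
  qed
qed

text \<open>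
  Since \<open>\<odot>\<close> preserves unions in its first argument, and both it and the union of a family are
  compatible with saturation of the arguments, it preserves joins.
\<close>

lemma op_distrib_left:
  assumes "F \<subseteq> Sat S cov" "Y \<in> Sat S cov"
  shows "sat_op S cov (\<odot>) (sat_join S cov F) Y
    = sat_join S cov ((\<lambda>X. sat_op S cov (\<odot>) X Y) ` F)"
proof -
  let ?A = "saturation S cov"
  have F: "\<Union>F \<subseteq> S" and FX: "\<And>X. X \<in> F \<Longrightarrow> X \<subseteq> S" and Y: "Y \<subseteq> S"
    using assms by (auto simp: Sat_def)
  have FY: "(\<Union>X\<in>F. X \<odot> Y) \<subseteq> S" by (intro UN_least op_closed FX Y)
  have "?A (?A (\<Union>F) \<odot> Y) = ?A (\<Union>F \<odot> Y)"
    using F Y by (simp add: saturation_op cov.saturation_idem cov.saturation_closed)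
  also have "\<Union>F \<odot> Y = (\<Union>X\<in>F. X \<odot> Y)"
    by (auto simp: lift_op_def)
  also have "?A \<dots> = ?A (\<Union>X\<in>F. ?A (X \<odot> Y))"
  proof
    have "X \<odot> Y \<subseteq> ?A (X \<odot> Y)" if "X \<in> F" for X
      using op_closed[OF FX[OF that] Y] by (rule cov.saturation_extensive)
    then have "(\<Union>X\<in>F. X \<odot> Y) \<subseteq> (\<Union>X\<in>F. ?A (X \<odot> Y))"
      by (rule UN_mono[OF subset_refl])
    moreover have A: "(\<Union>X\<in>F. ?A (X \<odot> Y)) \<subseteq> S"
      by (intro UN_least cov.saturation_closed)
    ultimately show "?A (\<Union>X\<in>F. X \<odot> Y) \<subseteq> ?A (\<Union>X\<in>F. ?A (X \<odot> Y))"
      by (rule cov.saturation_mono)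
    have "?A (X \<odot> Y) \<subseteq> ?A (\<Union>X\<in>F. X \<odot> Y)" if "X \<in> F" for X
      using UN_upper[OF that] FY by (rule cov.saturation_mono)
    then show "?A (\<Union>X\<in>F. ?A (X \<odot> Y)) \<subseteq> ?A (\<Union>X\<in>F. X \<odot> Y)"
      by (intro cov.saturation_least[OF A FY] UN_least)
  qed
  finally show ?thesis by (simp add: sat_op_def sat_join_def)
qed

lemma sat_op_commute:
  "X \<subseteq> S \<Longrightarrow> Y \<subseteq> S \<Longrightarrow> sat_op S cov (\<odot>) X Y = sat_op S cov (\<odot>) Y X"
  by (simp add: sat_op_def saturation_op Int_commute)

lemma op_distrib_right:
  assumes "F \<subseteq> Sat S cov" "Y \<in> Sat S cov"
  shows "sat_op S cov (\<odot>) Y (sat_join S cov F)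
    = sat_join S cov ((\<lambda>X. sat_op S cov (\<odot>) Y X) ` F)"
proof -
  have Y: "Y \<subseteq> S" and FX: "\<And>X. X \<in> F \<Longrightarrow> X \<subseteq> S"
    using assms by (auto simp: Sat_def)
  have "sat_join S cov F \<subseteq> S"
    by (simp add: sat_join_def cov.saturation_closed)
  moreover have "(\<lambda>X. sat_op S cov (\<odot>) Y X) ` F = (\<lambda>X. sat_op S cov (\<odot>) X Y) ` F"
    using FX Y by (intro image_cong sat_op_commute) auto
  ultimately show ?thesis
    using op_distrib_left[OF assms] sat_op_commute[OF Y] by simp
qed

lemma formal_cover_cov: "formal_cover S cov (\<odot>)"
  by unfold_locales
    (fact op_closed op_mono op_assoc op_comm op_distrib_left op_distrib_right saturation_op)+

subsection \<open>Minimality\<close>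

lemma cov_contains_gen_cover: "cover_le S (gen_cover S I C) cov"
proof (rule gen_cover_least)
  show "axiom_set S I C" "basic_cover S cov" by unfold_locales
  show "cov a (C a i)" if "a \<in> S" "i \<in> I a" for a i
    using cov_base[of a "Base1 i"] that by (simp add: J1_def)
qed

lemma cov_least:
  assumes "formal_cover S cov' circ'"
    and le: "cover_le S (gen_cover S I C) cov'"
    and ext: "\<And>a b. a \<in> S \<Longrightarrow> b \<in> S \<Longrightarrow>
      saturation S cov' (circ' {a} {b}) = saturation S cov' (\<delta> a b)"
  shows "cover_le S cov cov'"
proof -
  interpret F: formal_cover S cov' circ' by fact
  let ?A = "saturation S cov'"
  have A_op: "?A (U \<odot> V) = ?A U \<inter> ?A V" if "U \<subseteq> S" "V \<subseteq> S" for U V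
    using that \<delta>_closed ext by (intro F.saturation_lift_op)
  have in_A: "x \<in> ?A (U \<odot> V)" if "x \<in> U \<odot> V" "U \<subseteq> S" "V \<subseteq> S" for x U V
    using that F.saturation_extensive[OF op_closed] by blast
  have in_A_iff: "x \<in> ?A U \<longleftrightarrow> x \<in> S \<and> cov' x U" for x U
    by (auto simp: saturation_def)
  have base: "a \<in> ?A (D a j)" if a: "a \<in> S" and j: "j \<in> J a" for a j
  proof -
    from j consider
        i where "j = Base1 i" "i \<in> I a"
      | b c where "j = Comm b c" "b \<in> S" "c \<in> S" "a \<in> {b} \<odot> {c}"
      | b c d where "j = Assoc b c d" "b \<in> S" "c \<in> S" "d \<in> S" "a \<in> {b} \<odot> {c} \<odot> {d}"
      by (auto simp: J1_def)
    then show ?thesis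
    proof cases
      case 1
      have "gen_cover S I C a (C a i)"
        using axiom_set_axioms a 1(2) by (rule gen_cover_contains_axioms)
      then show ?thesis
        using le a 1 axiom_closed by (simp add: cover_le_def in_A_iff)
    next
      case 2
      have S: "{b} \<subseteq> S" "{c} \<subseteq> S" using 2 by auto
      have "a \<in> ?A ({c} \<odot> {b})"
        unfolding A_op[OF S(2,1)] using in_A[OF 2(4) S] unfolding A_op[OF S] by blast
      then show ?thesis using 2(1) by simp
    next
      case 3
      have S: "{b} \<subseteq> S" "{c} \<subseteq> S" "{d} \<subseteq> S" using 3 by auto
      have "a \<in> ?A ({b} \<odot> {c} \<odot> {d})" using in_A[OF 3(5)] S op_closed by blast
      also have "\<dots> = ?A ({b} \<odot> ({c} \<odot> {d}))"
        using S by (simp only: A_op op_closed Int_assoc)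
      finally show ?thesis using 3(1) by simp
    qed
  qed
  have "cov' a (D3 \<delta> (D2 \<delta> D) a k)" if a: "a \<in> S" and k: "k \<in> J3 S \<delta> (J2 S \<delta> J) a" for a k
  proof -
    from k consider
        j where "k = Base3 (Base2 j)" "j \<in> J a"
      | b j c where "k = Base3 (Localize b j c)" "b \<in> S" "c \<in> S" "j \<in> J b" "a \<in> {b} \<odot> {c}"
      | b c where "k = Weaken b c" "b \<in> S" "c \<in> S" "a \<in> {b} \<odot> {c}"
      | "k = Contract"
      by (auto simp: J3_def J2_def)
    then have "a \<in> ?A (D3 \<delta> (D2 \<delta> D) a k)"
    proof cases
      case 1
      then show ?thesis using base a by simp
    next
      case 2
      have S: "{b} \<subseteq> S" "{c} \<subseteq> S" using 2 by auto
      note D = D_closed[OF 2(2,4)]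
      have "?A {b} \<subseteq> ?A (D b j)"
        using base[OF 2(2,4)] by (intro F.saturation_least S D) simp
      then show ?thesis
        using in_A[OF 2(5) S] 2(1) by (auto simp only: A_op S D D3.simps D2.simps)
    next
      case 3
      have S: "{b} \<subseteq> S" "{c} \<subseteq> S" using 3 by auto
      show ?thesis using in_A[OF 3(4) S] 3(1) unfolding A_op[OF S] by simp
    next
      case 4
      have S: "{a} \<subseteq> S" using a by simp
      have "a \<in> ?A ({a} \<odot> {a})"
        unfolding A_op[OF S S] using F.saturation_extensive[OF S] by simp
      then show ?thesis using 4 by simp
    qed
    then show ?thesis by (simp add: in_A_iff)
  qed
  then show ?thesis
    unfolding formal_gen_cover_def
    by (intro gen_cover_least axiom_set_J3 F.basic_cover_axioms)
qed

end

theorem proposition5p9: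
  fixes S :: "'a set"
    and I :: "'a \<Rightarrow> 'i set"
    and C :: "'a \<Rightarrow> 'i \<Rightarrow> 'a set"
    and \<delta> :: "'a \<Rightarrow> 'a \<Rightarrow> 'a set"
  assumes "axiom_set S I C"
    and "\<And>a b. a \<in> S \<Longrightarrow> b \<in> S \<Longrightarrow> \<delta> a b \<subseteq> S"
  shows "formal_cover S (formal_gen_cover S I C \<delta>) (lift_op \<delta>)
    \<and> cover_le S (gen_cover S I C) (formal_gen_cover S I C \<delta>)
    \<and> (\<forall>a\<in>S. \<forall>b\<in>S. saturation S (formal_gen_cover S I C \<delta>) (lift_op \<delta> {a} {b})
                     = saturation S (formal_gen_cover S I C \<delta>) (\<delta> a b))
    \<and> (\<forall>cov' circ'.
          formal_cover S cov' circ'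
          \<longrightarrow> cover_le S (gen_cover S I C) cov'
          \<longrightarrow> (\<forall>a\<in>S. \<forall>b\<in>S. saturation S cov' (circ' {a} {b}) = saturation S cov' (\<delta> a b))
          \<longrightarrow> cover_le S (formal_gen_cover S I C \<delta>) cov')"
proof -
  interpret axiom_set_with_operation S I C \<delta>
    using assms by (simp add: axiom_set_with_operation_def axiom_set_with_operation_axioms_def)
  show ?thesis
    using formal_cover_cov cov_contains_gen_cover cov_least by simp
qed

end
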